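(* Let $n,k$ be positive integers and let $Q_a=(Q,\cdot)$, $Q=\{1,\ldots,n\}$, be a naturally ordered idempotent $k$-translatable quasigroup of order $n$ with multiplication $x\cdot y=[ax+by]_n$, $a,b\in\mathbb{Z}_n$ (so $[a+b]_n=1$ and $(a,n)=(b,n)=1$). Let $a',b'\in\mathbb{Z}_n$ be the elements with $[aa']_n=[bb']_n=1$. Then the multiplications of the parastrophes $(Q,\circ_i)$ of $Q_a$ have the form: (1) $x\circ_1 y=[(1-b')x+b'y]_n$; (2) $x\circ_2 y=[a'x+(1-a')y]_n$; (3) $x\circ_3 y=[(1-a')x+a'y]_n$; (4) $x\circ_4 y=[b'x+(1-b')y]_n$; (5) $x\circ_5 y=[bx+ay]_n$.
   Context: For an integer $m$, $[m]_n$ is the element of $\{1,\ldots,n\}$ congruent to $m$ modulo $n$, with $0=n$; an equation $[u]_n=v$ with $v$ an integer means $u\equiv v\pmod n$. A quasigroup is a set with a binary operation such that $ax=b$ and $xa=b$ are uniquely solvable for $x$; it is idempotent if $x\cdot x=x$. A groupoid on $\{1,\ldots,n\}$ is $k$-translatable if $i\cdot j=[i+1]_n\cdot[j+k]_n$ for all $i,j$. The parastrophes $(Q,\circ_i)$, $i=1,\ldots,5$, of a quasigroup $(Q,\cdot)$ are defined by: $x\circ_1y=z\Leftrightarrow x\cdot z=y$; $x\circ_2y=z\Leftrightarrow z\cdot y=x$; $x\circ_3y=z\Leftrightarrow z\cdot x=y$; $x\circ_4y=z\Leftrightarrow y\cdot z=x$; $x\circ_5y=z\Leftrightarrow y\cdot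 x=z$. *)

theory Defs
  imports "HOL-Number_Theory.Cong"
begin

text \<open>
  The representative of \<open>m\<close> modulo \<open>n\<close> in \<open>{1..n}\<close>. Unlike \<open>m mod n\<close>, multiples of \<open>n\<close> are
  represented by \<open>n\<close> rather than \<open>0\<close>.
\<close>

definition res :: "int \<Rightarrow> int \<Rightarrow> int" where
  "res n m = (if m mod n = 0 then n else m mod n)"

lemma res_mem: "n > 0 \<Longrightarrow> res n m \<in> {1..n}"
  using pos_mod_bound[of n m] pos_mod_sign[of n m] by (smt (verit) res_def atLeastAtMost_iff)

lemma res_cong: "[res n m = m] (mod n)"
  by (auto simp: res_def cong_def)

definition quasigroup_on :: "'a set \<Rightarrow> ('a \<Rightarrow> 'a \<Rightarrow> 'a) \<Rightarrow> bool" where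
  "quasigroup_on Q f \<longleftrightarrow>
     (\<forall>x\<in>Q. \<forall>y\<in>Q. f x y \<in> Q) \<and>
     (\<forall>a\<in>Q. \<forall>b\<in>Q. \<exists>!x. x \<in> Q \<and> f a x = b) \<and>
     (\<forall>a\<in>Q. \<forall>b\<in>Q. \<exists>!x. x \<in> Q \<and> f x a = b)"

definition idempotent_on :: "'a set \<Rightarrow> ('a \<Rightarrow> 'a \<Rightarrow> 'a) \<Rightarrow> bool" where
  "idempotent_on Q f \<longleftrightarrow> (\<forall>x\<in>Q. f x x = x)"

text \<open>
  Translatability refers to an ordering of the underlying set; here it is taken with respect to
  the natural ordering \<open>1, \<dots>, n\<close>.
\<close>

definition translatable :: "int \<Rightarrow> int \<Rightarrow> (int \<Rightarrow> int \<Rightarrow> int) \<Rightarrow> bool" where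
  "translatable n k f \<longleftrightarrow>
     (\<forall>i\<in>{1..n}. \<forall>j\<in>{1..n}. f i j = f (res n (i + 1)) (res n (j + k)))"

text \<open>
  The five non-trivial parastrophes. The descriptions are proper on a quasigroup, where the lemmas
  below give the defining equivalences.
\<close>

definition parastrophe1 :: "'a set \<Rightarrow> ('a \<Rightarrow> 'a \<Rightarrow> 'a) \<Rightarrow> 'a \<Rightarrow> 'a \<Rightarrow> 'a" where
  "parastrophe1 Q f x y = (THE z. z \<in> Q \<and> f x z = y)"

definition parastrophe2 :: "'a set \<Rightarrow> ('a \<Rightarrow> 'a \<Rightarrow> 'a) \<Rightarrow> 'a \<Rightarrow> 'a \<Rightarrow> 'a" where
  "parastrophe2 Q f x y = (THE z. z \<in> Q \<and> f z y = x)"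

definition parastrophe3 :: "'a set \<Rightarrow> ('a \<Rightarrow> 'a \<Rightarrow> 'a) \<Rightarrow> 'a \<Rightarrow> 'a \<Rightarrow> 'a" where
  "parastrophe3 Q f x y = (THE z. z \<in> Q \<and> f z x = y)"

definition parastrophe4 :: "'a set \<Rightarrow> ('a \<Rightarrow> 'a \<Rightarrow> 'a) \<Rightarrow> 'a \<Rightarrow> 'a \<Rightarrow> 'a" where
  "parastrophe4 Q f x y = (THE z. z \<in> Q \<and> f y z = x)"

definition parastrophe5 :: "'a set \<Rightarrow> ('a \<Rightarrow> 'a \<Rightarrow> 'a) \<Rightarrow> 'a \<Rightarrow> 'a \<Rightarrow> 'a" where
  "parastrophe5 Q f x y = (THE z. z \<in> Q \<and> f y x = z)"

lemma the_eq_iff_ex1: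
  assumes "\<exists>!z. P z"
  shows "P (The P)" and "The P = z \<longleftrightarrow> P z"
  using theI'[OF assms] the1_equality[OF assms] by metis+

lemma parastrophe_mem:
  assumes "quasigroup_on Q f" "x \<in> Q" "y \<in> Q"
  shows "parastrophe1 Q f x y \<in> Q" "parastrophe2 Q f x y \<in> Q" "parastrophe3 Q f x y \<in> Q"
    "parastrophe4 Q f x y \<in> Q" "parastrophe5 Q f x y \<in> Q"
proof -
  have ex: "\<exists>!z. z \<in> Q \<and> f u z = v" "\<exists>!z. z \<in> Q \<and> f z u = v" "\<exists>!z. z \<in> Q \<and> f u v = z"
    if "u \<in> Q" "v \<in> Q" for u v
    using assms(1) that unfolding quasigroup_on_def by auto
  show "parastrophe1 Q f x y \<in> Q" "parastrophe2 Q f x y \<in> Q" "parastrophe3 Q f x y \<in> Q"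
    "parastrophe4 Q f x y \<in> Q" "parastrophe5 Q f x y \<in> Q"
    unfolding parastrophe1_def parastrophe2_def parastrophe3_def parastrophe4_def parastrophe5_def
    using assms(2,3) ex[THEN the_eq_iff_ex1(1)] by blast+
qed

lemma parastrophe_eq_iff:
  assumes "quasigroup_on Q f" "x \<in> Q" "y \<in> Q" "z \<in> Q"
  shows "parastrophe1 Q f x y = z \<longleftrightarrow> f x z = y"
    and "parastrophe2 Q f x y = z \<longleftrightarrow> f z y = x"
    and "parastrophe3 Q f x y = z \<longleftrightarrow> f z x = y"
    and "parastrophe4 Q f x y = z \<longleftrightarrow> f y z = x"
    and "parastrophe5 Q f x y = z \<longleftrightarrow> f y x = z"
proof -
  have ex: "\<exists>!z. z \<in> Q \<and> f u z = v" "\<exists>!z. z \<in> Q \<and> f z u = v" "\<exists>!z. z \<in> Q \<and> f u v = z"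
    if "u \<in> Q" "v \<in> Q" for u v
    using assms(1) that unfolding quasigroup_on_def by auto
  note eq = ex[THEN the_eq_iff_ex1(2)]
  show "parastrophe1 Q f x y = z \<longleftrightarrow> f x z = y"
    using assms eq(1)[of x y z] by (simp add: parastrophe1_def)
  show "parastrophe2 Q f x y = z \<longleftrightarrow> f z y = x"
    using assms eq(2)[of y x z] by (simp add: parastrophe2_def)
  show "parastrophe3 Q f x y = z \<longleftrightarrow> f z x = y"
    using assms eq(2)[of x y z] by (simp add: parastrophe3_def)
  show "parastrophe4 Q f x y = z \<longleftrightarrow> f y z = x"
    using assms eq(1)[of y x z] by (simp add: parastrophe4_def)
  show "parastrophe5 Q f x y = z \<longleftrightarrow> f y x = z"
    using assms eq(3)[of y x z] by (simp add: parastrophe5_def)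
qed

end

theory Submission
  imports Defs
begin

text \<open>Idempotence at 1 gives \<open>a + b = 1\<close> modulo \<open>n\<close>. Solving
  \<open>a * x + b * z = y\<close> for the right factor gives \<open>z = b' * (y - a * x)\<close>,
  and \<open>b' * a = b' * (1 - b) = b' - 1\<close> turns this into
  \<open>(1 - b') * x + b' * y\<close>. Left factors are found by exchanging \<open>a\<close> and
  \<open>b\<close>. Parastrophes 1 and 4 are right-factor divisions, 2 and 3 left-factor ones, and 5
  is the opposite product. Since quotients in a quasigroup are unique, it suffices to check each
  candidate (\<open>affine_solution\<close>).\<close>

lemma res_eq_iff_cong:
  assumes "n > 0" "v \<in> {1..n}"
  shows "res n u = v \<longleftrightarrow> [u = v] (mod n)"
proof -
  have "res n v = v"
    using assms by (cases "v = n") (auto simp: res_def)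
  moreover have "res n u = res n v" if "[u = v] (mod n)"
    using that by (simp add: res_def cong_def)
  ultimately show ?thesis
    using res_cong[of n u] cong_sym by metis
qed

text \<open>The error of the candidate is a combination of \<open>a + b - 1\<close> and
  \<open>b * b' - 1\<close>, both divisible by \<open>n\<close>. As \<open>y\<close> lies in
  \<open>{1..n}\<close>, the congruence becomes an equality.\<close>

lemma affine_solution:
  fixes n a b b' x y :: int
  assumes "n > 0" "y \<in> {1..n}" "[a + b = 1] (mod n)" "[b * b' = 1] (mod n)"
  shows "res n (a * x + b * res n ((1 - b') * x + b' * y)) = y"
proof -
  have "a * x + b * ((1 - b') * x + b' * y) - y
      = (a + b - 1) * x + (b * b' - 1) * (y - x)"
    by (simp add: algebra_simps)
  moreover have "n dvd (a + b - 1) * x + (b * b' - 1) * (y - x)"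
    using assms by (simp add: cong_iff_dvd_diff)
  ultimately have "[a * x + b * ((1 - b') * x + b' * y) = y] (mod n)"
    by (simp add: cong_iff_dvd_diff)
  moreover have "[a * x + b * res n ((1 - b') * x + b' * y)
      = a * x + b * ((1 - b') * x + b' * y)] (mod n)"
    by (intro cong_add cong_mult cong_refl res_cong)
  ultimately show ?thesis
    using assms res_eq_iff_cong cong_trans by blast
qed

theorem theorem5p1:
  fixes n k a b a' b' :: int
    and Q :: "int set"
    and f :: "int \<Rightarrow> int \<Rightarrow> int"
  assumes "n > 0" and "k > 0"
    and "Q = {1..n}"
    and "a \<in> {1..n}" and "b \<in> {1..n}"
    and "\<And>x y. x \<in> Q \<Longrightarrow> y \<in> Q \<Longrightarrow> f x y = res n (a * x + b * y)"
    and "quasigroup_on Q f"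
    and "idempotent_on Q f"
    and "translatable n k f"
    and "a' \<in> {1..n}" and "b' \<in> {1..n}"
    and "[a * a' = 1] (mod n)" and "[b * b' = 1] (mod n)"
  shows "(\<forall>x\<in>Q. \<forall>y\<in>Q. parastrophe1 Q f x y = res n ((1 - b') * x + b' * y)) \<and>
    (\<forall>x\<in>Q. \<forall>y\<in>Q. parastrophe2 Q f x y = res n (a' * x + (1 - a') * y)) \<and>
    (\<forall>x\<in>Q. \<forall>y\<in>Q. parastrophe3 Q f x y = res n ((1 - a') * x + a' * y)) \<and>
    (\<forall>x\<in>Q. \<forall>y\<in>Q. parastrophe4 Q f x y = res n (b' * x + (1 - b') * y)) \<and>
    (\<forall>x\<in>Q. \<forall>y\<in>Q. parastrophe5 Q f x y = res n (b * x + a * y))"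
proof -
  note n = \<open>n > 0\<close> and Q = \<open>Q = {1..n}\<close> and f = assms(6)
  have "1 \<in> Q"
    using n Q by simp
  \<comment> \<open>This is the equation \<open>f 1 1 = 1\<close>.\<close>
  then have "res n (a + b) = 1"
    using f[of 1 1] \<open>idempotent_on Q f\<close> by (simp add: idempotent_on_def)
  then have ab: "[a + b = 1] (mod n)"
    using res_cong[of n "a + b"] by (simp add: cong_sym)
  then have ba: "[b + a = 1] (mod n)"
    by (simp add: add.commute)
  have mem: "res n u \<in> Q" for u
    using res_mem n Q by blast
  have right: "f x (res n ((1 - b') * x + b' * y)) = y" if "x \<in> Q" "y \<in> Q" for x y
    using affine_solution[OF n _ ab \<open>[b * b' = 1] (mod n)\<close>] that f mem Q by simp
  \<comment> \<open>Mirror image of \<open>right\<close>: \<open>affine_solution\<close> with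
    \<open>a\<close> and \<open>b\<close> exchanged.\<close>
  have left: "f (res n ((1 - a') * x + a' * y)) x = y" if "x \<in> Q" "y \<in> Q" for x y
    using affine_solution[OF n _ ba \<open>[a * a' = 1] (mod n)\<close>] that f mem Q
    by (simp add: add.commute)
  have swapped: "f y x = res n (b * x + a * y)" if "x \<in> Q" "y \<in> Q" for x y
    using f that by (simp add: add.commute)
  \<comment> \<open>With \<open>z\<close> a residue, each claim becomes a product equation.
    Parastrophes 2 and 4 use \<open>left\<close> and \<open>right\<close> with \<open>x\<close> and
    \<open>y\<close> interchanged.\<close>
  note iff = parastrophe_eq_iff[OF \<open>quasigroup_on Q f\<close> _ _ mem]
  show ?thesis
    using right left swapped by (auto simp: iff add.commute)
qed

end
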